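(* Suppose $\epsilon_{\max},\alpha\in(0,1/4)$ are constants satisfying $n\ge 1/\epsilon_{\max}$ and $\underline{q}(\epsilon_{\max})\le 1$. Then $$r_\alpha(\epsilon,[0,\epsilon_{\max}])\ge\underline{r}(\epsilon)\quad\text{for any }\epsilon\in[0,\epsilon_{\max}].$$
   Context: Location model: $X\sim P_\theta$ iff $X-\theta\sim P_0$, where $P_0$ is a distribution on $\mathbb{R}$ with a density $f$ that is continuous on its support and symmetric around $0$; $F$ is the CDF of $P_0$ and $F^{-1}(q)=\inf\{t\in\mathbb{R}:F(t)\ge q\}$. For $\epsilon\in[0,1]$, $\theta\in\mathbb{R}$ and an arbitrary distribution $Q$ on $\mathbb{R}$, $P_{\epsilon,\theta,Q}=(1-\epsilon)P_\theta+\epsilon Q$; the data are $X_1,\ldots,X_n\overset{iid}{\sim}P_{\epsilon,\theta,Q}$ and $P_{\epsilon,\theta,Q}(\cdot)$ of an event about the data is its probability under this sampling. For $\mathcal{E}\subset[0,1]$, $\mathcal{I}_\alpha(\mathcal{E})$ is the set of data-dependent intervals $\widehat{\mathrm{CI}}=[l(X_1,\ldots,X_n),u(X_1,\ldots,X_n)]$ (empty if $u<l$) with $\inf_{\epsilon\in\mathcal{E}}\inf_{\theta,Q}P_{\epsilon,\theta,Q}(\theta\in\widehat{\mathrm{CI}})\ge 1-\alpha$, and $$r_\alpha(\epsilon,\mathcal{E})=\inf\left\{r\ge 0:\ \inf_{\widehat{\mathrm{CI}}\in\mathcal{I}_\alpha(\mathcal{E})}\ \sup_{\theta,Q}P_{\epsilon,\theta,Q}\big(|\widehat{\mathrm{CI}}|\ge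 r\big)\le\alpha\right\},$$ where $|\cdot|$ is length (Lebesgue measure). With $a\vee b=\max(a,b)$, for $\epsilon\in[0,\epsilon_{\max}]$ define $$\underline{q}(\epsilon)=\frac{1}{2(1-\epsilon_{\max})}\left(\epsilon+\frac{\alpha(1-\epsilon_{\max})}{n}\right),$$ $$\underline{r}(\epsilon)=\sup\left\{r\ge 0:\ \sup_{t\le r+F^{-1}(1-\underline{q}(\epsilon))}\Big(f(t-r)-\frac{1-(\epsilon\vee\frac{\alpha}{n})}{1-\epsilon_{\max}}f(t)\Big)\le 0\right\}.$$ *)

theory Defs
  imports "HOL-Probability.Probability"
begin

definition location :: "real measure \<Rightarrow> real \<Rightarrow> real measure" where
  "location P0 \<theta> = distr P0 borel (\<lambda>x. x + \<theta>)"

definition contaminated :: "real measure \<Rightarrow> real \<Rightarrow> real \<Rightarrow> real measure \<Rightarrow> real measure" where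
  "contaminated P0 \<epsilon> \<theta> Q =
     measure_of UNIV (sets borel)
       (\<lambda>A. ennreal (1 - \<epsilon>) * emeasure (location P0 \<theta>) A + ennreal \<epsilon> * emeasure Q A)"

text \<open>A call to \<^const>\<open>measure_of\<close> is only meaningful if the given set function is a measure;
  the next lemmas confirm that this is the case here.\<close>

lemma sets_contaminated [simp, measurable_cong]:
  "sets (contaminated P0 \<epsilon> \<theta> Q) = sets borel"
proof -
  have "sigma_sets UNIV (sets (borel :: real measure)) = sets borel"
    using sets.sigma_sets_eq[of "borel :: real measure"] by simp
  then show ?thesis by (simp add: contaminated_def)
qed

lemma emeasure_contaminated:
  assumes "real_distribution Q" "A \<in> sets borel"
  shows "emeasure (contaminated P0 \<epsilon> \<theta> Q) A =
    ennreal (1 - \<epsilon>) * emeasure (location P0 \<theta>) A + ennreal \<epsilon> * emeasure Q A"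
proof (rule emeasure_measure_of[OF contaminated_def])
  interpret Q: real_distribution Q by fact
  show "countably_additive (sets (contaminated P0 \<epsilon> \<theta> Q))
     (\<lambda>A. ennreal (1 - \<epsilon>) * emeasure (location P0 \<theta>) A + ennreal \<epsilon> * emeasure Q A)"
  proof (rule countably_additiveI)
    fix B :: "nat \<Rightarrow> real set"
    assume B: "range B \<subseteq> sets (contaminated P0 \<epsilon> \<theta> Q)" "disjoint_family B"
    have "(\<Sum>i. ennreal (1 - \<epsilon>) * emeasure (location P0 \<theta>) (B i) + ennreal \<epsilon> * emeasure Q (B i))
      = ennreal (1 - \<epsilon>) * (\<Sum>i. emeasure (location P0 \<theta>) (B i))
        + ennreal \<epsilon> * (\<Sum>i. emeasure Q (B i))"
      by (simp add: suminf_add[symmetric] ennreal_suminf_cmult)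
    also have "(\<Sum>i. emeasure (location P0 \<theta>) (B i)) = emeasure (location P0 \<theta>) (\<Union>i. B i)"
      using B by (intro suminf_emeasure) (auto simp: location_def)
    also have "(\<Sum>i. emeasure Q (B i)) = emeasure Q (\<Union>i. B i)"
      using B by (intro suminf_emeasure) auto
    finally show "(\<Sum>i. ennreal (1 - \<epsilon>) * emeasure (location P0 \<theta>) (B i) + ennreal \<epsilon> * emeasure Q (B i))
      = ennreal (1 - \<epsilon>) * emeasure (location P0 \<theta>) (\<Union>i. B i) + ennreal \<epsilon> * emeasure Q (\<Union>i. B i)" .
  qed
qed (use assms in \<open>auto simp: positive_def\<close>)

lemma real_distribution_contaminated:
  assumes "real_distribution P0" "real_distribution Q" "0 \<le> \<epsilon>" "\<epsilon> \<le> 1"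
  shows "real_distribution (contaminated P0 \<epsilon> \<theta> Q)"
proof -
  interpret P: real_distribution P0 by fact
  interpret Q: real_distribution Q by fact
  have "prob_space (location P0 \<theta>)"
    unfolding location_def by (rule P.prob_space_distr) simp
  then have "emeasure (location P0 \<theta>) UNIV = 1"
    using prob_space.emeasure_space_1[of "location P0 \<theta>"] by (simp add: location_def)
  moreover have "emeasure Q UNIV = 1" using Q.emeasure_space_1 by simp
  ultimately have "emeasure (contaminated P0 \<epsilon> \<theta> Q) UNIV = 1"
    using assms by (simp add: emeasure_contaminated flip: ennreal_plus)
  moreover have "space (contaminated P0 \<epsilon> \<theta> Q) = UNIV"
    using sets_eq_imp_space_eq[OF sets_contaminated[of P0 \<epsilon> \<theta> Q]] by simp
  ultimately show ?thesis
    by (intro real_distribution.intro real_distribution_axioms.intro prob_spaceI) auto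
qed

text \<open>The law of the sample \<open>X 0, \<dots>, X (n - 1)\<close>.\<close>

definition sample :: "nat \<Rightarrow> real measure \<Rightarrow> real measure \<Rightarrow> real \<Rightarrow> real \<Rightarrow> (nat \<Rightarrow> real) measure" where
  "sample n P0 Q \<epsilon> \<theta> = PiM {..<n} (\<lambda>_. contaminated P0 \<epsilon> \<theta> Q)"

text \<open>A data-dependent interval is given by its pair of (Borel measurable) endpoint functions;
  for \<open>u X < l X\<close> the interval \<open>{l X..u X}\<close> is empty.\<close>

type_synonym data_interval = "((nat \<Rightarrow> real) \<Rightarrow> real) \<times> ((nat \<Rightarrow> real) \<Rightarrow> real)"

definition conf_interval :: "data_interval \<Rightarrow> (nat \<Rightarrow> real) \<Rightarrow> real set" where
  "conf_interval CI X = {fst CI X .. snd CI X}"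

definition conf_intervals ::
    "nat \<Rightarrow> real measure \<Rightarrow> real \<Rightarrow> real set \<Rightarrow> data_interval set" where
  "conf_intervals n P0 \<alpha> E =
    {CI. fst CI \<in> borel_measurable (PiM {..<n} (\<lambda>_. borel)) \<and>
         snd CI \<in> borel_measurable (PiM {..<n} (\<lambda>_. borel)) \<and>
         (INF \<epsilon>\<in>E. INF \<theta>. INF Q\<in>Collect real_distribution.
            ereal (measure (sample n P0 Q \<epsilon> \<theta>)
              {X \<in> space (sample n P0 Q \<epsilon> \<theta>). \<theta> \<in> conf_interval CI X})) \<ge> ereal (1 - \<alpha>)}"

text \<open>Extended reals, so that infima over empty sets are \<open>\<infinity>\<close>.\<close>

definition opt_length :: "nat \<Rightarrow> real measure \<Rightarrow> real \<Rightarrow> real \<Rightarrow> real set \<Rightarrow> ereal" where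
  "opt_length n P0 \<alpha> \<epsilon> E =
    (INF r\<in>{r::real. 0 \<le> r \<and>
        (INF CI\<in>conf_intervals n P0 \<alpha> E. SUP \<theta>. SUP Q\<in>Collect real_distribution.
           ereal (measure (sample n P0 Q \<epsilon> \<theta>)
             {X \<in> space (sample n P0 Q \<epsilon> \<theta>). measure lborel (conf_interval CI X) \<ge> r})) \<le> ereal \<alpha>}.
      ereal r)"

text \<open>Meaningful for \<open>0 < q < 1\<close>, where the set is nonempty and bounded below.\<close>

definition quantile :: "real measure \<Rightarrow> real \<Rightarrow> real" where
  "quantile P0 q = Inf {t. cdf P0 t \<ge> q}"

definition q_low :: "nat \<Rightarrow> real \<Rightarrow> real \<Rightarrow> real \<Rightarrow> real" where
  "q_low n \<alpha> \<epsilon>max \<epsilon> = 1 / (2 * (1 - \<epsilon>max)) * (\<epsilon> + \<alpha> * (1 - \<epsilon>max) / real n)"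

definition r_low ::
    "nat \<Rightarrow> real measure \<Rightarrow> (real \<Rightarrow> real) \<Rightarrow> real \<Rightarrow> real \<Rightarrow> real \<Rightarrow> ereal" where
  "r_low n P0 f \<alpha> \<epsilon>max \<epsilon> =
    (SUP r\<in>{r::real. 0 \<le> r \<and>
        (SUP t\<in>{..r + quantile P0 (1 - q_low n \<alpha> \<epsilon>max \<epsilon>)}.
           ereal (f (t - r) - (1 - max \<epsilon> (\<alpha> / real n)) / (1 - \<epsilon>max) * f t)) \<le> 0}.
      ereal r)"

end

theory Submission
  imports Defs
begin

text \<open>Let \<open>a = max \<epsilon> (\<alpha> / n)\<close>. If \<open>r\<close> is admissible in the definition of \<open>r_low\<close>, the part of
  \<open>(1 - \<epsilon>max) P\<^sub>r\<close> exceeding \<open>(1 - a) P\<^sub>0\<close> lives on a tail of mass at most \<open>a\<close>, so contaminations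
  exist with \<open>P\<^bsub>a,0,Q0\<^esub> = P\<^bsub>\<epsilon>max,r,Q1\<^esub>\<close>. This law dominates \<open>(1 - \<alpha> / n) P\<^bsub>\<epsilon>,0,Q0\<^esub>\<close>, hence its
  \<open>n\<close>-fold product dominates \<open>1 - \<alpha>\<close> times that of \<open>P\<^bsub>\<epsilon>,0,Q0\<^esub>\<close>. An interval that covers \<open>0\<close> under
  \<open>P\<^bsub>\<epsilon>,0,Q0\<^esub>\<close> and is shorter than \<open>r\<close> misses \<open>r\<close>, and would thus miss the true parameter too often
  under \<open>P\<^bsub>\<epsilon>max,r,Q1\<^esub>\<close>.\<close>

section \<open>Setwise domination of measures and of their finite powers\<close>

lemma nn_integral_scale_le:
  assumes sets: "sets M = sets N"
    and le: "\<And>A. A \<in> sets N \<Longrightarrow> k * emeasure M A \<le> emeasure N A"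
    and g: "g \<in> borel_measurable N"
  shows "k * (\<integral>\<^sup>+x. g x \<partial>M) \<le> (\<integral>\<^sup>+x. g x \<partial>N)"
proof -
  have "k * (\<integral>\<^sup>+x. g x \<partial>M) = (\<integral>\<^sup>+x. g x \<partial>scale_measure k M)"
    using g by (subst nn_integral_scale_measure) (simp_all cong: measurable_cong_sets add: sets)
  also have "\<dots> \<le> (\<integral>\<^sup>+x. g x \<partial>N)"
    using le by (intro nn_integral_mono_measure) (simp_all add: le_measure sets)
  finally show ?thesis .
qed

text \<open>By iterated integration, each coordinate costs one factor \<open>k\<close>. The claim
  concerns integrals of arbitrary \<open>g\<close> because, once a coordinate is split off, the
  induction hypothesis is applied to the sections of \<open>g\<close>.\<close>

lemma nn_integral_PiM_scale_le:
  fixes M N :: "'a measure" and k :: ennreal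
  assumes "finite I" "sigma_finite_measure M" "sigma_finite_measure N"
    and sets: "sets M = sets N"
    and le: "\<And>A. A \<in> sets N \<Longrightarrow> k * emeasure M A \<le> emeasure N A"
    and "g \<in> borel_measurable (PiM I (\<lambda>_. N))"
  shows "k ^ card I * (\<integral>\<^sup>+x. g x \<partial>PiM I (\<lambda>_. M)) \<le> (\<integral>\<^sup>+x. g x \<partial>PiM I (\<lambda>_. N))"
  using assms(1,6)
proof (induction I arbitrary: g rule: finite_induct)
  case empty
  then show ?case by (simp add: PiM_empty nn_integral_count_space_finite)
next
  case (insert i I)
  interpret M: product_sigma_finite "\<lambda>_. M" using assms(2) by (simp add: product_sigma_finite_def)
  interpret N: product_sigma_finite "\<lambda>_. N" using assms(3) by (simp add: product_sigma_finite_def)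
  note [measurable_cong] = sets
  have [measurable]: "g \<in> borel_measurable (PiM (insert i I) (\<lambda>_. N))" by fact
  have "sets (PiM (insert i I) (\<lambda>_. M)) = sets (PiM (insert i I) (\<lambda>_. N))"
    by (intro sets_PiM_cong) (simp_all add: sets)
  then have [measurable]: "g \<in> borel_measurable (PiM (insert i I) (\<lambda>_. M))"
    using insert.prems by (simp cong: measurable_cong_sets)
  interpret IN: sigma_finite_measure "PiM I (\<lambda>_. N)" by (rule N.sigma_finite[OF insert.hyps(1)])
  interpret IM: sigma_finite_measure "PiM I (\<lambda>_. M)" by (rule M.sigma_finite[OF insert.hyps(1)])
  \<comment> \<open>The new coordinate \<open>y\<close> is integrated outermost:
    \<open>k ^ card I\<close> moves inside to meet the induction hypothesis, and the single
    \<open>k\<close> is kept for \<open>y\<close>.\<close>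
  have "k ^ card (insert i I) * (\<integral>\<^sup>+x. g x \<partial>PiM (insert i I) (\<lambda>_. M))
      = k * (k ^ card I * (\<integral>\<^sup>+y. (\<integral>\<^sup>+x. g (x(i := y)) \<partial>PiM I (\<lambda>_. M)) \<partial>M))"
    using insert.hyps by (simp add: M.product_nn_integral_insert_rev mult.assoc)
  also have "\<dots> = k * (\<integral>\<^sup>+y. k ^ card I * (\<integral>\<^sup>+x. g (x(i := y)) \<partial>PiM I (\<lambda>_. M)) \<partial>M)"
    by (subst nn_integral_cmult) auto
  also have "\<dots> \<le> k * (\<integral>\<^sup>+y. (\<integral>\<^sup>+x. g (x(i := y)) \<partial>PiM I (\<lambda>_. N)) \<partial>M)"
  proof (intro mult_left_mono nn_integral_mono)
    fix y assume "y \<in> space M"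
    then have "y \<in> space N" using sets_eq_imp_space_eq[OF sets] by simp
    then have "(\<lambda>x. g (x(i := y))) \<in> borel_measurable (PiM I (\<lambda>_. N))" by measurable
    then show "k ^ card I * (\<integral>\<^sup>+x. g (x(i := y)) \<partial>PiM I (\<lambda>_. M))
        \<le> (\<integral>\<^sup>+x. g (x(i := y)) \<partial>PiM I (\<lambda>_. N))"
      by (rule insert.IH)
  qed simp
  also have "\<dots> \<le> (\<integral>\<^sup>+y. (\<integral>\<^sup>+x. g (x(i := y)) \<partial>PiM I (\<lambda>_. N)) \<partial>N)"
    by (rule nn_integral_scale_le[OF sets le]) auto
  also have "\<dots> = (\<integral>\<^sup>+x. g x \<partial>PiM (insert i I) (\<lambda>_. N))"
    using insert.hyps by (simp add: N.product_nn_integral_insert_rev)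
  finally show ?case .
qed

lemma measure_PiM_scale_le:
  fixes M N :: "'a measure" and k :: real
  assumes "finite I" "prob_space M" "prob_space N" "0 \<le> k"
    and sets: "sets M = sets N"
    and le: "\<And>A. A \<in> sets N \<Longrightarrow> k * measure M A \<le> measure N A"
    and A: "A \<in> sets (PiM I (\<lambda>_. N))"
  shows "k ^ card I * measure (PiM I (\<lambda>_. M)) A \<le> measure (PiM I (\<lambda>_. N)) A"
proof -
  interpret M: prob_space M by fact
  interpret N: prob_space N by fact
  interpret PM: prob_space "PiM I (\<lambda>_. M)" by (intro prob_space_PiM assms)
  interpret PN: prob_space "PiM I (\<lambda>_. N)" by (intro prob_space_PiM assms)
  have sets': "sets (PiM I (\<lambda>_. M)) = sets (PiM I (\<lambda>_. N))"
    by (intro sets_PiM_cong) (simp_all add: sets)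
  have "ennreal k ^ card I * (\<integral>\<^sup>+x. indicator A x \<partial>PiM I (\<lambda>_. M))
      \<le> (\<integral>\<^sup>+x. indicator A x \<partial>PiM I (\<lambda>_. N))"
  proof (rule nn_integral_PiM_scale_le)
    show "ennreal k * emeasure M B \<le> emeasure N B" if "B \<in> sets N" for B
      using le[OF that] \<open>0 \<le> k\<close>
      by (simp add: M.emeasure_eq_measure N.emeasure_eq_measure flip: ennreal_mult)
  qed (use assms in \<open>auto intro: prob_space_imp_sigma_finite\<close>)
  then show ?thesis
    using A \<open>0 \<le> k\<close> sets'
    by (simp add: PM.emeasure_eq_measure PN.emeasure_eq_measure ennreal_power flip: ennreal_mult)
qed

section \<open>Lebesgue densities of shifted and contaminated laws\<close>

lemma location_density:
  assumes [measurable]: "f \<in> borel_measurable borel"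
  shows "location (density lborel f) \<theta> = density lborel (\<lambda>x. f (x - \<theta>))"
proof -
  \<comment> \<open>Translation invariance: \<open>lborel\<close> is written as its own image under
    the shift, so that the density can be pulled back along that map.\<close>
  have "density lborel (\<lambda>x. f (x - \<theta>)) = density (distr lborel borel ((+) \<theta>)) (\<lambda>x. f (x - \<theta>))"
    by (simp add: lborel_distr_plus)
  also have "\<dots> = distr (density lborel f) borel ((+) \<theta>)"
    by (subst density_distr) auto
  finally show ?thesis by (simp add: location_def add.commute[of _ \<theta>] cong: distr_cong)
qed

lemma contaminated_density:
  fixes f g :: "real \<Rightarrow> real"
  assumes [measurable]: "f \<in> borel_measurable borel" "g \<in> borel_measurable borel"
    and nonneg: "\<And>x. 0 \<le> f x" "\<And>x. 0 \<le> g x" "0 \<le> \<epsilon>" "\<epsilon> \<le> 1"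
    and Q: "real_distribution (density lborel g)"
  shows "contaminated (density lborel f) \<epsilon> \<theta> (density lborel g)
    = density lborel (\<lambda>x. (1 - \<epsilon>) * f (x - \<theta>) + \<epsilon> * g x)"
proof (rule measure_eqI)
  fix A assume "A \<in> sets (contaminated (density lborel f) \<epsilon> \<theta> (density lborel g))"
  then have A[measurable]: "A \<in> sets borel" by simp
  have "emeasure (contaminated (density lborel f) \<epsilon> \<theta> (density lborel g)) A
    = ennreal (1 - \<epsilon>) * (\<integral>\<^sup>+x. ennreal (f (x - \<theta>)) * indicator A x \<partial>lborel)
      + ennreal \<epsilon> * (\<integral>\<^sup>+x. ennreal (g x) * indicator A x \<partial>lborel)"
    using Q A by (simp add: emeasure_contaminated location_density emeasure_density)
  also have "\<dots> = (\<integral>\<^sup>+x. ennreal (1 - \<epsilon>) * (ennreal (f (x - \<theta>)) * indicator A x)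
      + ennreal \<epsilon> * (ennreal (g x) * indicator A x) \<partial>lborel)"
    by (simp add: nn_integral_add nn_integral_cmult)
  also have "\<dots> = emeasure (density lborel (\<lambda>x. (1 - \<epsilon>) * f (x - \<theta>) + \<epsilon> * g x)) A"
    using nonneg by (auto simp: emeasure_density ennreal_mult split: split_indicator intro!: nn_integral_cong)
  finally show "emeasure (contaminated (density lborel f) \<epsilon> \<theta> (density lborel g)) A
    = emeasure (density lborel (\<lambda>x. (1 - \<epsilon>) * f (x - \<theta>) + \<epsilon> * g x)) A" .
qed simp

lemma real_distribution_density:
  fixes g :: "real \<Rightarrow> real"
  assumes "integrable lborel g" "\<And>x. 0 \<le> g x" "(\<integral>x. g x \<partial>lborel) = 1"
  shows "real_distribution (density lborel g)"
proof -
  have [measurable]: "g \<in> borel_measurable borel"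
    using borel_measurable_integrable[OF assms(1)] by simp
  have "prob_space (density lborel g)"
    using assms by (intro prob_spaceI) (simp add: emeasure_density nn_integral_eq_integral)
  then show ?thesis
    by (simp add: real_distribution_def real_distribution_axioms_def)
qed

text \<open>Two densities scaled to masses \<open>1 - a\<close> and \<open>1 - b\<close> can be completed to the same probability
  density as soon as the excess of the second over the first has mass at most \<open>a\<close>.\<close>

lemma common_contamination:
  fixes f :: "real \<Rightarrow> real"
  assumes f: "integrable lborel f" "\<And>x. 0 \<le> f x" "(\<integral>x. f x \<partial>lborel) = 1"
    and a: "0 < a" "a \<le> 1" and b: "0 < b" "b \<le> 1"
    and excess: "(\<integral>x. max 0 ((1 - b) * f (x - r) - (1 - a) * f x) \<partial>lborel) \<le> a"
  obtains Q R where "real_distribution Q" "real_distribution R"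
    "contaminated (density lborel f) a 0 Q = contaminated (density lborel f) b r R"
proof -
  have [measurable]: "f \<in> borel_measurable borel"
    using borel_measurable_integrable[OF f(1)] by simp
  have shift: "integrable lborel (\<lambda>x. f (x - r))" "(\<integral>x. f (x - r) \<partial>lborel) = 1"
    using lborel_integrable_real_affine[OF f(1), of 1 "- r"]
      lborel_integral_real_affine[of 1 f "- r"] f(3) by simp_all
  define E where "E x = max 0 ((1 - b) * f (x - r) - (1 - a) * f x)" for x
  define m where "m = (\<integral>x. E x \<partial>lborel)"
  have E: "integrable lborel E"
    unfolding E_def using f(1) shift(1) by (intro integrable_max integrable_diff) auto
  have m: "m \<le> a" using excess by (simp add: m_def E_def)
  \<comment> \<open>\<open>E\<close> uses only mass \<open>m\<close> of the budget \<open>a\<close>;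
    the rest is filled with a multiple of \<open>f\<close>, so that \<open>a * g\<close> has mass
    exactly \<open>a\<close>.\<close>
  define g where "g x = (E x + (a - m) * f x) / a" for x
  \<comment> \<open>Forced by equality of the two mixtures. It is nonnegative because
    \<open>a * g\<close> is at least \<open>E\<close>, and the masses balance to
    \<open>((1 - a) + a - (1 - b)) / b = 1\<close>.\<close>
  define h where "h x = ((1 - a) * f x + a * g x - (1 - b) * f (x - r)) / b" for x
  have ag: "a * g x = E x + (a - m) * f x" for x using a by (simp add: g_def)
  have bh: "b * h x = (1 - a) * f x + a * g x - (1 - b) * f (x - r)" for x using b by (simp add: h_def)
  have g0: "0 \<le> g x" for x
    unfolding g_def using a m f(2)[of x] by (simp add: E_def)
  have gi: "integrable lborel g" unfolding g_def using E f(1) by auto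
  have "(\<integral>x. g x \<partial>lborel) = (m + (a - m)) / a"
    unfolding g_def using E f by (simp add: m_def)
  then have g1: "(\<integral>x. g x \<partial>lborel) = 1" using a by simp
  have "(1 - b) * f (x - r) - (1 - a) * f x \<le> a * g x" for x
    unfolding ag using m f(2)[of x] by (simp add: E_def add_increasing2)
  then have h0: "0 \<le> h x" for x
    unfolding h_def using b by (simp add: field_simps)
  have hi: "integrable lborel h" unfolding h_def using gi f(1) shift(1) by auto
  have "(\<integral>x. h x \<partial>lborel) = ((1 - a) + a - (1 - b)) / b"
    unfolding h_def using gi f shift g1 by simp
  then have h1: "(\<integral>x. h x \<partial>lborel) = 1" using b by simp
  have [measurable]: "g \<in> borel_measurable borel" "h \<in> borel_measurable borel"
    using borel_measurable_integrable[OF gi] borel_measurable_integrable[OF hi] by simp_all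
  have Q: "real_distribution (density lborel g)" by (rule real_distribution_density[OF gi g0 g1])
  have R: "real_distribution (density lborel h)" by (rule real_distribution_density[OF hi h0 h1])
  have "contaminated (density lborel f) a 0 (density lborel g)
      = contaminated (density lborel f) b r (density lborel h)"
    using a b f(2) g0 h0 Q R by (simp add: contaminated_density bh)
  with Q R that show thesis by blast
qed

section \<open>Mass of the excess beyond a quantile\<close>

lemma cdf_quantile_ge:
  assumes "real_distribution M" "0 < q" "q < 1"
  shows "q \<le> cdf M (quantile M q)"
proof -
  interpret cdf_distribution M using assms(1) by (simp add: cdf_distribution_def)
  \<comment> \<open>Right continuity of the CDF makes \<open>q \<le> cdf M x\<close> equivalent to
    \<open>quantile M q \<le> x\<close>; here \<open>x\<close> is the quantile itself.\<close>
  show ?thesis using pseudoinverse[OF assms(2,3), of "quantile M q"] by (simp add: quantile_def)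
qed

text \<open>Up to \<open>r\<close> plus the quantile, the density inequality makes the excess
  vanish. Further right it is at most \<open>(1 - b) * f (x - r)\<close>, whose integral there is
  \<open>1 - b\<close> times the mass of \<open>f\<close> above its \<open>1 - q\<close>
  quantile.\<close>

lemma excess_mass_le:
  fixes f :: "real \<Rightarrow> real"
  assumes f: "integrable lborel f" "\<And>x. 0 \<le> f x" "(\<integral>x. f x \<partial>lborel) = 1"
    and q: "0 < q" "q < 1" and b: "b < 1"
    and le: "\<And>t. t \<le> r + quantile (density lborel f) (1 - q) \<Longrightarrow> f (t - r) \<le> (1 - a) / (1 - b) * f t"
    and a: "a \<le> 1"
  shows "(\<integral>x. max 0 ((1 - b) * f (x - r) - (1 - a) * f x) \<partial>lborel) \<le> (1 - b) * q"
proof -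
  have [measurable]: "f \<in> borel_measurable borel"
    using borel_measurable_integrable[OF f(1)] by simp
  have D: "real_distribution (density lborel f)" by (rule real_distribution_density[OF f])
  interpret real_distribution "density lborel f" by (rule D)
  define \<tau> where "\<tau> = quantile (density lborel f) (1 - q)"
  have shift: "integrable lborel (\<lambda>x. f (x - r))"
    using lborel_integrable_real_affine[OF f(1), of 1 "- r"] by simp
  have int: "integrable lborel (\<lambda>x. indicator {\<tau><..} (x - r) * f (x - r))"
    using integrable_real_mult_indicator[OF _ shift, of "{\<tau> + r<..}"]
    by (simp add: indicator_def less_diff_eq mult.commute)
  have "(\<integral>x. max 0 ((1 - b) * f (x - r) - (1 - a) * f x) \<partial>lborel)
      \<le> (\<integral>x. (1 - b) * (indicator {\<tau><..} (x - r) * f (x - r)) \<partial>lborel)"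
  proof (rule integral_mono)
    show "max 0 ((1 - b) * f (x - r) - (1 - a) * f x)
      \<le> (1 - b) * (indicator {\<tau><..} (x - r) * f (x - r))" for x
    proof (cases "x - r \<le> \<tau>")
      case True
      then have "f (x - r) \<le> (1 - a) / (1 - b) * f x" using le[of x] by (simp add: \<tau>_def)
      then show ?thesis using b True by (simp add: field_simps)
    next
      case False
      then show ?thesis using a b f(2)[of x] f(2)[of "x - r"] by simp
    qed
  qed (use f(1) shift int in auto)
  \<comment> \<open>Substituting \<open>x - r\<close> for the variable turns the tail of the shifted
    density into the tail of \<open>f\<close> itself.\<close>
  also have "\<dots> = (1 - b) * (\<integral>x. indicator {\<tau><..} x * f x \<partial>lborel)"
    using lborel_integral_real_affine[of 1 "\<lambda>x. indicator {\<tau><..} x * f x" "- r"] by simp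
  also have "(\<integral>x. indicator {\<tau><..} x * f x \<partial>lborel) = prob {\<tau><..}"
  proof -
    have "prob {\<tau><..} = (\<integral>x. indicator {\<tau><..} x \<partial>density lborel f)" by simp
    also have "\<dots> = (\<integral>x. f x * indicator {\<tau><..} x \<partial>lborel)"
      by (subst integral_real_density) (use f in auto)
    finally show ?thesis by (simp add: mult.commute)
  qed
  also have "prob {\<tau><..} = 1 - cdf (density lborel f) \<tau>"
    using prob_compl[of "{..\<tau>}"] by (simp add: cdf_def Compl_eq_Diff_UNIV[symmetric] Compl_atMost)
  also have "\<dots> \<le> q" using cdf_quantile_ge[OF D, of "1 - q"] q by (simp add: \<tau>_def)
  finally show ?thesis using b by simp
qed

section \<open>Change of contamination level and the two-point argument for intervals\<close>

lemma contaminated_scale_le: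
  assumes P0: "real_distribution P0" and Q: "real_distribution Q"
    and eps: "0 \<le> \<epsilon>" "\<epsilon> \<le> a" "a \<le> 1" and A: "A \<in> sets borel"
    and k: "0 \<le> k" "k \<le> 1" "k * (1 - \<epsilon>) \<le> 1 - a"
  shows "k * measure (contaminated P0 \<epsilon> \<theta> Q) A \<le> measure (contaminated P0 a \<theta> Q) A"
proof -
  interpret P: real_distribution P0 by fact
  interpret Q: real_distribution Q by fact
  interpret L: prob_space "location P0 \<theta>"
    unfolding location_def by (rule P.prob_space_distr) simp
  have meas: "measure (contaminated P0 e \<theta> Q) A = (1 - e) * measure (location P0 \<theta>) A + e * measure Q A"
    if "0 \<le> e" "e \<le> 1" for e
  proof -
    have "emeasure (contaminated P0 e \<theta> Q) A
      = ennreal ((1 - e) * measure (location P0 \<theta>) A + e * measure Q A)"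
      using that by (simp add: emeasure_contaminated[OF Q A] L.emeasure_eq_measure
          Q.emeasure_eq_measure ennreal_mult)
    then show ?thesis using that by (intro measure_eq_emeasure_eq_ennreal) auto
  qed
  \<comment> \<open>With \<open>Q\<close> fixed, raising the level from \<open>\<epsilon>\<close> to
    \<open>a\<close> lowers only the weight of the shifted \<open>P0\<close>, and \<open>k\<close>
    absorbs that loss.\<close>
  have "k * ((1 - \<epsilon>) * measure (location P0 \<theta>) A) \<le> (1 - a) * measure (location P0 \<theta>) A"
    using mult_right_mono[OF k(3), of "measure (location P0 \<theta>) A"] by (simp add: mult.assoc)
  moreover have "k * \<epsilon> \<le> a" using mult_right_mono[OF k(2) eps(1)] eps by simp
  then have "k * (\<epsilon> * measure Q A) \<le> a * measure Q A"
    using mult_right_mono[of "k * \<epsilon>" a "measure Q A"] by (simp add: mult.assoc)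
  ultimately show ?thesis using eps by (simp add: meas distrib_left)
qed

lemma conf_intervals_coverage:
  assumes "CI \<in> conf_intervals n P0 \<alpha> E" "\<epsilon> \<in> E" "real_distribution Q"
  shows "1 - \<alpha> \<le> measure (sample n P0 Q \<epsilon> \<theta>)
    {X \<in> space (sample n P0 Q \<epsilon> \<theta>). \<theta> \<in> conf_interval CI X}"
proof -
  let ?m = "\<lambda>\<epsilon> \<theta> Q. ereal (measure (sample n P0 Q \<epsilon> \<theta>)
    {X \<in> space (sample n P0 Q \<epsilon> \<theta>). \<theta> \<in> conf_interval CI X})"
  have "ereal (1 - \<alpha>) \<le> (INF \<epsilon>\<in>E. INF \<theta>. INF Q\<in>Collect real_distribution. ?m \<epsilon> \<theta> Q)"
    using assms(1) by (simp add: conf_intervals_def)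
  also have "\<dots> \<le> (INF \<theta>. INF Q\<in>Collect real_distribution. ?m \<epsilon> \<theta> Q)"
    using assms(2) by (rule INF_lower)
  also have "\<dots> \<le> (INF Q\<in>Collect real_distribution. ?m \<epsilon> \<theta> Q)"
    by (rule INF_lower) simp
  also have "\<dots> \<le> ?m \<epsilon> \<theta> Q"
    using assms(3) by (intro INF_lower) simp
  finally show ?thesis by simp
qed

text \<open>Origin of \<open>1 - 3 * \<alpha>\<close>: if long intervals were no likelier than this,
  covering \<open>0\<close> with a short one would have probability at least
  \<open>2 * \<alpha>\<close>. Passing to the law with parameter \<open>r\<close> costs a factor
  \<open>1 - \<alpha>\<close>, and \<open>(1 - \<alpha>) * (2 * \<alpha>)\<close> exceeds the
  permitted error \<open>\<alpha>\<close> when \<open>\<alpha> < 1 / 2\<close>.\<close>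

lemma not_short_covering_interval:
  assumes P0: "real_distribution P0" and Q: "real_distribution Q" and R: "real_distribution R"
    and \<alpha>: "0 < \<alpha>" "\<alpha> < 1 / 2" and "0 < n"
    and eps: "0 \<le> \<epsilon>" "\<epsilon> \<le> a" "a \<le> 1" "\<epsilon> \<in> E" "b \<in> E"
    and k: "(1 - \<alpha> / real n) * (1 - \<epsilon>) \<le> 1 - a"
    and eq: "contaminated P0 a 0 Q = contaminated P0 b r R"
    and CI: "CI \<in> conf_intervals n P0 \<alpha> E" and s: "s \<le> r"
  shows "1 - 3 * \<alpha> < measure (sample n P0 Q \<epsilon> 0)
    {X \<in> space (sample n P0 Q \<epsilon> 0). measure lborel (conf_interval CI X) \<ge> s}"
proof (rule ccontr)
  define M where "M = sample n P0 Q \<epsilon> 0"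
  define N where "N = sample n P0 R b r"
  note cont = real_distribution_contaminated[OF P0 Q]
  \<comment> \<open>\<open>N\<close> is used in two readings: centred at \<open>0\<close> with level
    \<open>a\<close> for the comparison with \<open>M\<close>, and centred at \<open>r\<close> with
    level \<open>b\<close> for the coverage guarantee.\<close>
  have N_eq: "N = PiM {..<n} (\<lambda>_. contaminated P0 a 0 Q)" by (simp add: N_def sample_def eq)
  have prob: "prob_space (contaminated P0 \<epsilon> 0 Q)" "prob_space (contaminated P0 a 0 Q)"
    using cont[of \<epsilon>] cont[of a] eps by (auto simp: real_distribution_def)
  interpret M: prob_space M unfolding M_def sample_def by (intro prob_space_PiM prob)
  interpret N: prob_space N unfolding N_eq by (intro prob_space_PiM prob)
  have sM[measurable_cong]: "sets M = sets (PiM {..<n} (\<lambda>_. borel))"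
    unfolding M_def sample_def by (intro sets_PiM_cong) simp_all
  have sN[measurable_cong]: "sets N = sets (PiM {..<n} (\<lambda>_. borel))"
    unfolding N_eq by (intro sets_PiM_cong) simp_all
  have sp: "space N = space M" using sets_eq_imp_space_eq[of N M] sM sN by simp
  have [measurable]: "fst CI \<in> borel_measurable (PiM {..<n} (\<lambda>_. borel))"
    "snd CI \<in> borel_measurable (PiM {..<n} (\<lambda>_. borel))"
    using CI by (simp_all add: conf_intervals_def)
  \<comment> \<open>Reversed endpoints give the empty interval, of length 0, hence the
    \<open>max\<close>; in this form \<open>B\<close> is visibly measurable.\<close>
  have len: "measure lborel (conf_interval CI X) = max 0 (snd CI X - fst CI X)" for X
    by (simp add: conf_interval_def max_def)
  define A where "A = {X \<in> space M. 0 \<in> conf_interval CI X}"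
  define B where "B = {X \<in> space M. measure lborel (conf_interval CI X) \<ge> s}"
  define C where "C = {X \<in> space M. r \<in> conf_interval CI X}"
  have A: "A \<in> sets M"
    unfolding A_def conf_interval_def atLeastAtMost_iff by measurable
  have B: "B \<in> sets M"
    unfolding B_def len by measurable
  have C[measurable]: "C \<in> sets M"
    unfolding C_def conf_interval_def atLeastAtMost_iff by measurable
  have CN: "C \<in> sets N" using C sM sN by simp
  assume "\<not> ?thesis"
  then have "M.prob B \<le> 1 - 3 * \<alpha>" by (simp add: B_def M_def)
  moreover have "1 - \<alpha> \<le> M.prob A"
    using conf_intervals_coverage[OF CI eps(4) Q, of 0] by (simp add: A_def M_def)
  ultimately have "2 * \<alpha> \<le> M.prob A - M.prob B" by simp
  also have "\<dots> \<le> M.prob (A - B)" by (rule measure_diff_le_measure_setdiff) (simp_all add: M.fmeasurable_eq_sets A B)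
  also have "\<dots> \<le> M.prob (space M - C)"
  proof (rule M.finite_measure_mono)
    \<comment> \<open>Off \<open>B\<close> the nonnegative length is below \<open>s \<le> r\<close>,
      so \<open>r\<close> is positive; an interval containing both \<open>0\<close> and
      \<open>r\<close> would have length at least \<open>r\<close>.\<close>
    show "A - B \<subseteq> space M - C"
      using s by (auto simp: A_def B_def C_def len) (auto simp: conf_interval_def)
  qed auto
  finally have *: "2 * \<alpha> \<le> M.prob (space M - C)" .
  have \<alpha>n: "\<alpha> / real n \<le> 1" using \<alpha> \<open>0 < n\<close> by (simp add: field_simps)
  \<comment> \<open>Bernoulli's inequality: a relative loss of \<open>\<alpha> / real n\<close> per
    observation adds up to at most \<open>\<alpha>\<close> over the whole sample.\<close>
  have "1 - \<alpha> \<le> (1 - \<alpha> / real n) ^ n"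
    using Bernoulli_inequality[of "- (\<alpha> / real n)" n] \<alpha>n \<open>0 < n\<close> by simp
  then have "(1 - \<alpha>) * (2 * \<alpha>) \<le> (1 - \<alpha> / real n) ^ n * M.prob (space M - C)"
    using * \<alpha> by (intro mult_mono) auto
  also have "\<dots> \<le> N.prob (space M - C)"
  proof -
    have "(1 - \<alpha> / real n) ^ card {..<n} * measure (PiM {..<n} (\<lambda>_. contaminated P0 \<epsilon> 0 Q)) (space M - C)
      \<le> measure (PiM {..<n} (\<lambda>_. contaminated P0 a 0 Q)) (space M - C)"
    proof (rule measure_PiM_scale_le[OF _ prob])
      show "(1 - \<alpha> / real n) * measure (contaminated P0 \<epsilon> 0 Q) D \<le> measure (contaminated P0 a 0 Q) D"
        if "D \<in> sets (contaminated P0 a 0 Q)" for D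
        using contaminated_scale_le[OF P0 Q eps(1-3) _ _ _ k] that \<alpha> \<alpha>n by simp
      show "space M - C \<in> sets (PiM {..<n} (\<lambda>_. contaminated P0 a 0 Q))"
        unfolding N_eq[symmetric] sp[symmetric] using CN by auto
    qed (use \<alpha>n in auto)
    then show ?thesis by (simp add: M_def N_eq sample_def)
  qed
  also have "\<dots> = 1 - N.prob C" using N.prob_compl[OF CN] by (simp add: sp)
  also have "\<dots> \<le> \<alpha>"
    using conf_intervals_coverage[OF CI eps(5) R, of r] by (simp add: C_def N_def flip: sp)
  finally have "\<alpha> * (1 - 2 * \<alpha>) \<le> 0" by (simp add: algebra_simps)
  moreover have "0 < \<alpha> * (1 - 2 * \<alpha>)" using \<alpha> by simp
  ultimately show False by simp
qed

section \<open>Choice of levels and comparison of \<open>r_low\<close> with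
  \<open>opt_length\<close>\<close>

theorem corollary2:
  fixes P0 :: "real measure" and f :: "real \<Rightarrow> real"
    and n :: nat and \<alpha> \<epsilon>max \<epsilon> :: real
  assumes P0_prob: "prob_space P0"
    and f_meas: "f \<in> borel_measurable borel"
    and f_nonneg: "\<And>x. 0 \<le> f x"
    and P0_density: "P0 = density lborel (\<lambda>x. ennreal (f x))"
    and f_cont: "continuous_on {x. f x > 0} f"
    and f_sym: "\<And>x. f (- x) = f x"
    and \<epsilon>max: "0 < \<epsilon>max" "\<epsilon>max < 1 / 4"
    and \<alpha>: "0 < \<alpha>" "\<alpha> < 1 / 4"
    and n: "real n \<ge> 1 / \<epsilon>max"
    and q: "q_low n \<alpha> \<epsilon>max \<epsilon>max \<le> 1"
    and \<epsilon>: "\<epsilon> \<in> {0..\<epsilon>max}"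
  shows "opt_length n P0 \<alpha> \<epsilon> {0..\<epsilon>max} \<ge> r_low n P0 f \<alpha> \<epsilon>max \<epsilon>"
proof -
  define \<rho> where "\<rho> = \<alpha> / real n"
  define a where "a = max \<epsilon> \<rho>"
  define q where "q = q_low n \<alpha> \<epsilon>max \<epsilon>"
  have n0: "0 < n" using n \<epsilon>max by (auto intro: gr0I)
  \<comment> \<open>The sample size condition enters here: it gives
    \<open>\<rho> \<le> \<epsilon>max\<close>, hence \<open>a \<le> \<epsilon>max\<close>.\<close>
  have "1 \<le> \<epsilon>max * real n" using n \<epsilon>max by (simp add: field_simps)
  moreover have "\<alpha> \<le> 1" using \<alpha> by simp
  ultimately have "\<alpha> \<le> \<epsilon>max * real n" by linarith
  then have \<rho>: "0 < \<rho>" "\<rho> \<le> \<epsilon>max" using \<alpha> n0 by (simp_all add: \<rho>_def field_simps)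
  have a: "0 < a" "a \<le> \<epsilon>max" "\<epsilon> \<le> a" "\<rho> \<le> a" using \<rho> \<epsilon> by (auto simp: a_def)
  \<comment> \<open>The prefactor of \<open>q_low\<close> cancels, leaving the average of
    \<open>\<epsilon>\<close> and \<open>\<rho> * (1 - \<epsilon>max)\<close>. Both are at most
    \<open>a\<close>, so the excess fits into the contamination budget.\<close>
  have q_mass: "(1 - \<epsilon>max) * q = (\<epsilon> + \<rho> * (1 - \<epsilon>max)) / 2"
  proof -
    have "(1 - \<epsilon>max) * (1 / (2 * (1 - \<epsilon>max)) * x) = x / 2" for x
      using \<epsilon>max by (simp add: field_simps)
    then show ?thesis by (simp add: q_def q_low_def \<rho>_def)
  qed
  have "\<rho> * (1 - \<epsilon>max) \<le> \<rho> * 1" using \<rho> \<epsilon>max by (intro mult_left_mono) auto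
  then have mass: "(1 - \<epsilon>max) * q \<le> a" using q_mass a by simp
  have "0 < (\<epsilon> + \<rho> * (1 - \<epsilon>max)) / 2" using \<rho> \<epsilon> \<epsilon>max by (simp add: add_nonneg_pos)
  then have q0: "0 < q"
    using zero_less_mult_pos[of "1 - \<epsilon>max" q] q_mass \<epsilon>max by simp
  \<comment> \<open>Together with \<open>q0\<close> this places \<open>1 - q\<close> strictly inside
    the unit interval, where \<open>quantile\<close> is a genuine quantile.\<close>
  have "(1 - \<epsilon>max) * q < 1 - \<epsilon>max" using mass a \<epsilon>max by linarith
  then have q1: "q < 1" using mult_less_cancel_left_pos[of "1 - \<epsilon>max" q 1] \<epsilon>max by simp
  have P0: "real_distribution P0"
    using P0_prob by (simp add: P0_density real_distribution_def real_distribution_axioms_def)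
  have "(\<integral>\<^sup>+x. ennreal (f x) \<partial>lborel) = ennreal 1"
    using prob_space.emeasure_space_1[OF P0_prob] f_meas by (simp add: P0_density emeasure_density)
  then have f: "integrable lborel f" "(\<integral>x. f x \<partial>lborel) = 1"
    using f_nonneg f_meas nn_integral_eq_integrable[of f lborel 1] by simp_all
  \<comment> \<open>Of the two factors, keep the one belonging to the larger of
    \<open>\<rho>\<close> and \<open>\<epsilon>\<close> and bound the other by 1.\<close>
  have "(1 - \<rho>) * (1 - \<epsilon>) \<le> 1 - a"
  proof (cases "\<epsilon> \<le> \<rho>")
    case True
    have "(1 - \<rho>) * (1 - \<epsilon>) \<le> (1 - \<rho>) * 1" using \<rho> \<epsilon> \<epsilon>max by (intro mult_left_mono) auto
    then show ?thesis using True by (simp add: a_def)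
  next
    case False
    have "(1 - \<rho>) * (1 - \<epsilon>) \<le> 1 * (1 - \<epsilon>)" using \<rho> \<epsilon> \<epsilon>max by (intro mult_right_mono) auto
    then show ?thesis using False by (simp add: a_def)
  qed
  note k = this[unfolded \<rho>_def]
  show ?thesis
    unfolding r_low_def opt_length_def
  \<comment> \<open>It suffices to compare each \<open>r\<close> admissible for \<open>r_low\<close>
    with each \<open>s\<close> admissible for \<open>opt_length\<close>.\<close>
  proof (intro SUP_least INF_greatest; clarify)
    fix r s :: real
    assume r: "(SUP t\<in>{..r + quantile P0 (1 - q_low n \<alpha> \<epsilon>max \<epsilon>)}.
        ereal (f (t - r) - (1 - max \<epsilon> (\<alpha> / real n)) / (1 - \<epsilon>max) * f t)) \<le> 0"
      and s: "(INF CI\<in>conf_intervals n P0 \<alpha> {0..\<epsilon>max}. SUP \<theta>. SUP Q\<in>Collect real_distribution.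
        ereal (measure (sample n P0 Q \<epsilon> \<theta>) {X \<in> space (sample n P0 Q \<epsilon> \<theta>).
          s \<le> measure lborel (conf_interval CI X)})) \<le> ereal \<alpha>"
    have dom: "f (t - r) \<le> (1 - a) / (1 - \<epsilon>max) * f t" if "t \<le> r + quantile P0 (1 - q)" for t
      using r that by (auto simp: SUP_le_iff q_def a_def \<rho>_def)
    have "(\<integral>x. max 0 ((1 - \<epsilon>max) * f (x - r) - (1 - a) * f x) \<partial>lborel) \<le> (1 - \<epsilon>max) * q"
      using f f_nonneg q0 q1 \<epsilon>max a dom by (intro excess_mass_le) (auto simp: P0_density)
    also note mass
    finally have excess: "(\<integral>x. max 0 ((1 - \<epsilon>max) * f (x - r) - (1 - a) * f x) \<partial>lborel) \<le> a" .
    obtain Q R where QR: "real_distribution Q" "real_distribution R"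
      "contaminated P0 a 0 Q = contaminated P0 \<epsilon>max r R"
      unfolding P0_density
      using common_contamination[OF f(1) f_nonneg f(2) a(1) _ \<epsilon>max(1) _ excess] a \<epsilon>max by auto
    show "ereal r \<le> ereal s"
    proof (rule ccontr)
      assume "\<not> ereal r \<le> ereal s"
      then have sr: "s \<le> r" by simp
      \<comment> \<open>This is exactly \<open>\<alpha> < 1 / 4\<close>. The strict gap yields an
        actual \<open>CI\<close> although the infimum over intervals may not be attained.\<close>
      have "ereal \<alpha> < ereal (1 - 3 * \<alpha>)" using \<alpha> by simp
      with s have "(INF CI\<in>conf_intervals n P0 \<alpha> {0..\<epsilon>max}. SUP \<theta>. SUP Q\<in>Collect real_distribution.
        ereal (measure (sample n P0 Q \<epsilon> \<theta>) {X \<in> space (sample n P0 Q \<epsilon> \<theta>).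
          s \<le> measure lborel (conf_interval CI X)})) < ereal (1 - 3 * \<alpha>)"
        by (rule le_less_trans)
      then obtain CI where CI: "CI \<in> conf_intervals n P0 \<alpha> {0..\<epsilon>max}"
        and short: "(SUP \<theta>. SUP Q\<in>Collect real_distribution.
          ereal (measure (sample n P0 Q \<epsilon> \<theta>) {X \<in> space (sample n P0 Q \<epsilon> \<theta>).
            s \<le> measure lborel (conf_interval CI X)})) < ereal (1 - 3 * \<alpha>)"
        by (auto simp: INF_less_iff)
      \<comment> \<open>The worst case over parameters and contaminations is specialised to
        \<open>0\<close> and the constructed \<open>Q\<close>.\<close>
      have "measure (sample n P0 Q \<epsilon> 0) {X \<in> space (sample n P0 Q \<epsilon> 0).
            s \<le> measure lborel (conf_interval CI X)} \<le> 1 - 3 * \<alpha>"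
        using less_imp_le[OF short] QR(1) by (auto simp: SUP_le_iff)
      moreover have "1 - 3 * \<alpha> < measure (sample n P0 Q \<epsilon> 0) {X \<in> space (sample n P0 Q \<epsilon> 0).
            s \<le> measure lborel (conf_interval CI X)}"
        by (rule not_short_covering_interval[OF P0 QR(1,2) \<alpha>(1) _ n0 _ a(3) _ \<epsilon> _ k QR(3) CI sr])
          (use \<alpha> \<epsilon> \<epsilon>max a in auto)
      ultimately show False by simp
    qed
  qed
qed

end
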